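(* Let $\lambda,c>0$ and consider a bus line with stops $\mathbf{J}=\{0,1,\dots,J\}$, boarding demand rates $f_j(t)$ and origin-destination ratios $\beta_{od}(t)$. Let $$r_j(t)=\sum_{o=0}^{j}f_o(t)-\sum_{o=0}^{j-1}\sum_{d=o+1}^{j}f_o(t)\beta_{od}(t),\qquad r_m(t)=\max_{j\in\mathbf{J}}r_j(t).$$ Then the optimal solution of the off-peak scheduling problem $$\min_{g(\cdot)}\ \mathcal{J}_{op}=\int_{t\in\mathbf{E}_{op}}\left[\lambda g(t)+\sum_{j=0}^{J}\frac{c f_j(t)}{2g(t)}\right]dt\quad\text{subject to}\quad g(t)\ge r_m(t),\ t\in\mathbf{E}_{op},$$ is $$g_{op}^*(t)=\max\left\{\sqrt{\frac{c}{2\lambda}\sum_{j=0}^{J}f_j(t)},\ r_m(t)\right\},\qquad t\in\mathbf{E}_{op}.$$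
   Context: $f_j(t)$ (patrons per hour) is the arrival rate of boarding patrons at stop $j$ at time $t+\tau_j$, where $\tau_j$ is the bus travel time from the depot to stop $j$; thus $t$ is the dispatch time of the bus serving them. $\beta_{od}(t)=f_{od}(t)/f_o(t)$ is the ratio of the demand at stop $o$ that travels to stop $d$, where $f_{od}$ is the demand between the stop pair $o,d\in\mathbf{J}$. $r_j(t)$ is the cross-sectional demand flux departing from stop $j$, and $r_m(t)$ is the maximum cross-sectional departing flux along the line. $g(t)$ is the dispatching rate in seats per hour, $c$ is the bus size (seats per bus), and $\lambda$ is the operation cost per dispatched seat. $\mathbf{E}_{op}$ is the off-peak period, i.e. the set of times when the fleet size constraint is not binding. It is assumed that $\lambda$ is small-valued so that any queue is prevented from forming during the off-peak period while the fleet size constraint is not activated; this no-queue requirement is expressed by $g(t)\ge r_m(t)$. *)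

theory Defs
  imports "HOL-Analysis.Analysis"
begin

text \<open>
  Demand data: \<open>f j t\<close> is the boarding rate at stop \<open>j\<close> and \<open>fod i d t\<close> the demand from stop \<open>i\<close>
  to stop \<open>d\<close>, both already shifted by the travel time from the depot, so that \<open>t\<close> is a dispatch
  time. The stops are \<open>{..J}\<close>. Origins are written \<open>i\<close> since \<open>o\<close> denotes composition in HOL.
\<close>

text \<open>
  If \<open>f i t = 0\<close> this is \<open>0\<close>, which is immaterial: the ratio is only used multiplied by \<open>f i t\<close>.
\<close>
definition od_ratio ::
  "(nat \<Rightarrow> real \<Rightarrow> real) \<Rightarrow> (nat \<Rightarrow> nat \<Rightarrow> real \<Rightarrow> real) \<Rightarrow> nat \<Rightarrow> nat \<Rightarrow> real \<Rightarrow> real" where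
  "od_ratio f fod i d t = fod i d t / f i t"

definition dep_flux ::
  "(nat \<Rightarrow> real \<Rightarrow> real) \<Rightarrow> (nat \<Rightarrow> nat \<Rightarrow> real \<Rightarrow> real) \<Rightarrow> nat \<Rightarrow> real \<Rightarrow> real" where
  "dep_flux f \<beta> j t = (\<Sum>i\<le>j. f i t) - (\<Sum>i<j. \<Sum>d=i+1..j. f i t * \<beta> i d t)"

definition max_dep_flux ::
  "nat \<Rightarrow> (nat \<Rightarrow> real \<Rightarrow> real) \<Rightarrow> (nat \<Rightarrow> nat \<Rightarrow> real \<Rightarrow> real) \<Rightarrow> real \<Rightarrow> real" where
  "max_dep_flux J f \<beta> t = Max ((\<lambda>j. dep_flux f \<beta> j t) ` {..J})"

text \<open>
  The integral takes values in \<open>[0, \<infinity>]\<close>, so every feasible schedule has a well-defined cost, which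
  is \<open>\<infinity>\<close> if the integral diverges. For demands with \<open>f j t \<ge> 0\<close>, \<open>fod i d t \<ge> 0\<close> and
  \<open>(\<Sum>d=i+1..J. fod i d t) \<le> f i t\<close>, one has \<open>max_dep_flux \<ge> f j t\<close> for every stop \<open>j\<close>. Hence a
  feasible \<open>g\<close> makes the integrand nonnegative, and \<open>g t = 0\<close> happens only if all \<open>f j t\<close> vanish;
  the integrand is then \<open>0\<close> (no dispatches, no patrons).
\<close>
definition op_cost ::
  "real \<Rightarrow> real \<Rightarrow> nat \<Rightarrow> (nat \<Rightarrow> real \<Rightarrow> real) \<Rightarrow> real set \<Rightarrow> (real \<Rightarrow> real) \<Rightarrow> ennreal" where
  "op_cost lam c J f E g =
     (\<integral>\<^sup>+ t. ennreal (lam * g t + (\<Sum>j\<le>J. c * f j t / (2 * g t))) \<partial>lebesgue_on E)"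

definition op_feasible :: "(real \<Rightarrow> real) \<Rightarrow> real set \<Rightarrow> (real \<Rightarrow> real) \<Rightarrow> bool" where
  "op_feasible rm E g \<longleftrightarrow> g \<in> borel_measurable (lebesgue_on E) \<and> (\<forall>t\<in>E. g t \<ge> rm t)"

definition op_optimal ::
  "real \<Rightarrow> real \<Rightarrow> nat \<Rightarrow> (nat \<Rightarrow> real \<Rightarrow> real) \<Rightarrow> (real \<Rightarrow> real) \<Rightarrow> real set \<Rightarrow> (real \<Rightarrow> real) \<Rightarrow> bool" where
  "op_optimal lam c J f rm E g \<longleftrightarrow>
     op_feasible rm E g \<and> (\<forall>h. op_feasible rm E h \<longrightarrow> op_cost lam c J f E g \<le> op_cost lam c J f E h)"

end

theory Submission
  imports Defs
begin

text \<open>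
  Where \<open>f i t = 0\<close>, the bound on the demands out of \<open>i\<close> makes all of them vanish, so
  \<open>f i t * od_ratio f fod i d t = fod i d t\<close> always and the flux at stop \<open>j\<close> is at least \<open>f j t\<close>.
  In particular a feasible rate is positive wherever there is demand. The constrained problem then
  decouples over \<open>t\<close>: with \<open>A = c / 2 * (\<Sum>j\<le>J. f j t)\<close> and \<open>s\<^sup>2 = A / lam\<close> one has
  \<open>(lam * h + A / h) - (lam * g + A / g) = lam * (h - g) * (g * h - s\<^sup>2) / (g * h)\<close>, which is
  positive for \<open>g = max s r\<close> and every \<open>h \<ge> r\<close> other than \<open>g\<close> when \<open>A > 0\<close>; without demand the
  integrand is just \<open>lam * h\<close>, also at \<open>h = 0\<close> because \<open>0 / 0 = 0\<close>. Integration gives optimality, and a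
  second optimiser of finite cost can differ from \<open>g_op\<close> only on a null set.
\<close>

text \<open>The problem at a single time, with \<open>A\<close> standing for half of
  \<open>c\<close> times the total demand. The premise \<open>A > 0 \<Longrightarrow> r > 0\<close>
  keeps \<open>h\<close> off the pole of \<open>A / h\<close>; strictness is what later yields
  uniqueness.\<close>

lemma linear_plus_reciprocal_strict_min:
  fixes lam A r h :: real
  defines "g \<equiv> max (sqrt (A / lam)) r"
  assumes "lam > 0" "A \<ge> 0" "r \<ge> 0" "A > 0 \<Longrightarrow> r > 0" "h \<ge> r" "h \<noteq> g"
  shows "lam * g + A / g < lam * h + A / h"
proof (cases "A = 0")
  case True
  then show ?thesis using assms by (auto simp: g_def)
next
  case False
  define s where "s = sqrt (A / lam)"
  have pos: "0 < r" "0 < g" "0 < h" using False assms by (auto simp: max_def)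
  have A: "A = lam * s\<^sup>2" and s: "s \<ge> 0" using assms by (auto simp: s_def)
  have g: "g = max s r" by (simp add: g_def s_def)
  \<comment> \<open>Both factors have the same sign. Above \<open>g\<close>,
    \<open>g * h > g * g \<ge> s * s\<close>. Below \<open>g\<close>, \<open>h \<ge> r\<close> rules
    out \<open>g = r\<close>, so \<open>g = s\<close> and \<open>g * h < s * s\<close>.\<close>
  have "(h - g) * (g * h - s\<^sup>2) > 0"
  proof (cases "h > g")
    case True
    have "s * s \<le> g * g" using s g by (intro mult_mono) auto
    also have "\<dots> < g * h" using True pos by simp
    finally show ?thesis using True by (simp add: power2_eq_square)
  next
    case False
    then have "h < s" "g = s" using g assms by auto
    then show ?thesis using pos by (simp add: power2_eq_square mult_neg_neg)
  qed
  then have "0 < lam * ((h - g) * (g * h - s\<^sup>2) / (g * h))" using pos assms by simp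
  also have "\<dots> = (lam * h + A / h) - (lam * g + A / g)"
    using pos unfolding A by (simp add: field_simps power2_eq_square)
  finally show ?thesis by simp
qed

lemma f_mult_od_ratio:
  assumes "\<And>d. i < d \<Longrightarrow> d \<le> J \<Longrightarrow> fod i d t \<ge> 0" "(\<Sum>d=i+1..J. fod i d t) \<le> f i t"
    and "i < d" "d \<le> J"
  shows "f i t * od_ratio f fod i d t = fod i d t"
proof -
  have "fod i d t \<le> (\<Sum>d=i+1..J. fod i d t)"
    using assms by (intro member_le_sum) auto
  then have "f i t = 0 \<Longrightarrow> fod i d t = 0" using assms by fastforce
  then show ?thesis by (auto simp: od_ratio_def)
qed

text \<open>Each stop \<open>i < j\<close> sends at most \<open>f i t\<close> patrons to stops up to
  \<open>j\<close>, so the subtracted alightings cannot exceed the boardings before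
  \<open>j\<close>; the boardings at \<open>j\<close> itself remain.\<close>

lemma boarding_le_dep_flux:
  assumes nonneg: "\<And>i d. i < d \<Longrightarrow> d \<le> J \<Longrightarrow> fod i d t \<ge> 0"
    and bound: "\<And>i. i \<le> J \<Longrightarrow> (\<Sum>d=i+1..J. fod i d t) \<le> f i t"
    and "j \<le> J"
  shows "f j t \<le> dep_flux f (od_ratio f fod) j t"
proof -
  have "(\<Sum>d=i+1..j. f i t * od_ratio f fod i d t) \<le> f i t" if "i < j" for i
  proof -
    have "(\<Sum>d=i+1..j. f i t * od_ratio f fod i d t) = (\<Sum>d=i+1..j. fod i d t)"
      using that assms by (intro sum.cong refl f_mult_od_ratio[of _ J]) auto
    also have "\<dots> \<le> (\<Sum>d=i+1..J. fod i d t)"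
      using nonneg \<open>j \<le> J\<close> by (intro sum_mono2) auto
    finally show ?thesis using bound[of i] that \<open>j \<le> J\<close> by simp
  qed
  then have "(\<Sum>i<j. \<Sum>d=i+1..j. f i t * od_ratio f fod i d t) \<le> (\<Sum>i<j. f i t)"
    by (intro sum_mono) auto
  then show ?thesis by (simp add: dep_flux_def lessThan_Suc_atMost[symmetric])
qed

lemma boarding_le_max_dep_flux:
  assumes "\<And>i d. i < d \<Longrightarrow> d \<le> J \<Longrightarrow> fod i d t \<ge> 0"
    and "\<And>i. i \<le> J \<Longrightarrow> (\<Sum>d=i+1..J. fod i d t) \<le> f i t"
    and "j \<le> J"
  shows "f j t \<le> max_dep_flux J f (od_ratio f fod) t"
  unfolding max_dep_flux_def
  using boarding_le_dep_flux[of J fod t f j] assms by (intro order.trans[OF _ Max_ge]) auto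

lemma borel_measurable_max_dep_flux:
  assumes [measurable]: "\<And>j. j \<le> J \<Longrightarrow> f j \<in> borel_measurable M"
    and "\<And>i d. i < d \<Longrightarrow> d \<le> J \<Longrightarrow> \<beta> i d \<in> borel_measurable M"
  shows "max_dep_flux J f \<beta> \<in> borel_measurable M"
proof -
  have "dep_flux f \<beta> j \<in> borel_measurable M" if "j \<le> J" for j
    unfolding dep_flux_def[abs_def] using that assms
    by (intro borel_measurable_diff borel_measurable_sum borel_measurable_times) auto
  then show ?thesis
    unfolding max_dep_flux_def[abs_def] by (intro borel_measurable_Max) auto
qed

theorem mainTheorem3:
  fixes lam c :: real
    and J :: nat
    and f :: "nat \<Rightarrow> real \<Rightarrow> real"
    and fod :: "nat \<Rightarrow> nat \<Rightarrow> real \<Rightarrow> real"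
    and \<beta> :: "nat \<Rightarrow> nat \<Rightarrow> real \<Rightarrow> real"
    and r_m g_op :: "real \<Rightarrow> real"
    and E_op :: "real set"
  assumes "lam > 0" and "c > 0"
    and "E_op \<in> sets lebesgue"
    and "\<And>j. j \<le> J \<Longrightarrow> f j \<in> borel_measurable (lebesgue_on E_op)"
    and "\<And>i d. i < d \<Longrightarrow> d \<le> J \<Longrightarrow> fod i d \<in> borel_measurable (lebesgue_on E_op)"
    and "\<And>j t. j \<le> J \<Longrightarrow> t \<in> E_op \<Longrightarrow> f j t \<ge> 0"
    and "\<And>i d t. i < d \<Longrightarrow> d \<le> J \<Longrightarrow> t \<in> E_op \<Longrightarrow> fod i d t \<ge> 0"
    and "\<And>i t. i \<le> J \<Longrightarrow> t \<in> E_op \<Longrightarrow> (\<Sum>d=i+1..J. fod i d t) \<le> f i t"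
    and "\<beta> = od_ratio f fod"
    and "r_m = max_dep_flux J f \<beta>"
    and "g_op = (\<lambda>t. max (sqrt (c / (2 * lam) * (\<Sum>j\<le>J. f j t))) (r_m t))"
  shows "op_optimal lam c J f r_m E_op g_op \<and>
    (\<forall>g. op_optimal lam c J f r_m E_op g \<and> op_cost lam c J f E_op g < \<infinity> \<longrightarrow>
         (AE t in lebesgue_on E_op. g t = g_op t))"
proof -
  note lam = assms(1) and c = assms(2) and f_meas = assms(4) and fod_meas = assms(5)
    and f_nonneg = assms(6) and fod_nonneg = assms(7) and fod_sum = assms(8) and \<beta> = assms(9)
    and r_m = assms(10) and g_op = assms(11)
  define M where "M = lebesgue_on E_op"
  define S where "S t = (\<Sum>j\<le>J. f j t)" for t
  define \<phi> where "\<phi> h t = lam * h t + (\<Sum>j\<le>J. c * f j t / (2 * h t))" for h t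
  have space: "space M = E_op" by (simp add: M_def)
  have cost: "op_cost lam c J f E_op h = (\<integral>\<^sup>+t. ennreal (\<phi> h t) \<partial>M)" for h
    by (simp add: op_cost_def \<phi>_def M_def)
  \<comment> \<open>This covers \<open>h t = 0\<close> as well, where every quotient is
    \<open>0\<close>.\<close>
  have \<phi>_eq: "\<phi> h t = lam * h t + (c / 2 * S t) / h t" for h t
    unfolding \<phi>_def S_def by (simp add: sum_distrib_left sum_divide_distrib)
  have g_op_eq: "g_op t = max (sqrt ((c / 2 * S t) / lam)) (r_m t)" for t
    by (simp add: g_op S_def)

  have f_le_r: "f j t \<le> r_m t" if "j \<le> J" "t \<in> E_op" for j t
    unfolding r_m \<beta> using fod_nonneg fod_sum that by (intro boarding_le_max_dep_flux) auto
  \<comment> \<open>Stop \<open>0\<close> exists for every \<open>J\<close>, so its boarding rate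
    serves as the lower bound.\<close>
  have r_nonneg: "0 \<le> r_m t" if "t \<in> E_op" for t
    using f_nonneg[of 0 t] f_le_r[of 0 t] that by simp
  have S_nonneg: "0 \<le> S t" if "t \<in> E_op" for t
    unfolding S_def using f_nonneg that by (intro sum_nonneg) auto
  have r_pos: "0 < r_m t" if "0 < S t" "t \<in> E_op" for t
  proof (rule ccontr)
    assume "\<not> 0 < r_m t"
    then have "S t \<le> 0" unfolding S_def
      using f_le_r that by (intro sum_nonpos) force
    then show False using that by simp
  qed
  have less: "\<phi> g_op t < \<phi> h t" if "t \<in> E_op" "r_m t \<le> h t" "h t \<noteq> g_op t" for h t
    unfolding \<phi>_eq g_op_eq
    using that lam c S_nonneg[of t] r_nonneg[of t] r_pos[of t]
    by (intro linear_plus_reciprocal_strict_min) (auto simp: g_op_eq zero_less_mult_iff)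
  have le: "\<phi> g_op t \<le> \<phi> h t" if "t \<in> E_op" "r_m t \<le> h t" for h t
    using less[of t h, OF that] by (cases "h t = g_op t") (auto simp: \<phi>_eq)
  have \<phi>_nonneg: "0 \<le> \<phi> h t" if "t \<in> E_op" "r_m t \<le> h t" for h t
    using that lam c S_nonneg[of t] r_nonneg[of t] by (auto simp: \<phi>_eq)

  have f_M[measurable]: "f j \<in> borel_measurable M" if "j \<le> J" for j
    using f_meas that by (simp add: M_def)
  have "od_ratio f fod i d \<in> borel_measurable M" if "i < d" "d \<le> J" for i d
    unfolding od_ratio_def[abs_def] using f_M[of i] fod_meas[of i d] that by (simp add: M_def)
  then have r_M[measurable]: "r_m \<in> borel_measurable M"
    unfolding r_m \<beta> by (intro borel_measurable_max_dep_flux f_M)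
  have S_M[measurable]: "S \<in> borel_measurable M"
    unfolding S_def[abs_def] by (intro borel_measurable_sum) auto
  have g_op_M[measurable]: "g_op \<in> borel_measurable M"
    unfolding g_op_eq[abs_def] by measurable
  have \<phi>_M: "\<phi> h \<in> borel_measurable M" if [measurable]: "h \<in> borel_measurable M" for h
    unfolding \<phi>_eq[abs_def] by measurable

  have feasible: "op_feasible r_m E_op g_op"
    using g_op_M by (simp add: op_feasible_def M_def g_op)
  have optimal: "op_optimal lam c J f r_m E_op g_op"
    unfolding op_optimal_def cost
    using feasible le by (auto simp: op_feasible_def space intro!: nn_integral_mono ennreal_leI)
  have "AE t in M. g t = g_op t"
    if opt: "op_optimal lam c J f r_m E_op g" and fin: "op_cost lam c J f E_op g < \<infinity>" for g
  proof -
    have g_M: "g \<in> borel_measurable M" and g_ge: "\<And>t. t \<in> E_op \<Longrightarrow> r_m t \<le> g t"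
      using opt by (auto simp: op_optimal_def op_feasible_def M_def)
    have g_le: "op_cost lam c J f E_op g \<le> op_cost lam c J f E_op g_op"
      using opt feasible by (simp add: op_optimal_def)
    have op_fin: "op_cost lam c J f E_op g_op < \<infinity>"
      using optimal opt fin by (auto simp: op_optimal_def intro: le_less_trans)
    \<comment> \<open>Otherwise the integrand of \<open>g\<close> exceeds that of
      \<open>g_op\<close> on a non-null set and is almost nowhere below it. As the cost of
      \<open>g_op\<close> is finite, the integrals then differ strictly, against the optimality of
      \<open>g\<close>.\<close>
    have "AE t in M. ennreal (\<phi> g t) \<le> ennreal (\<phi> g_op t)"
    proof (rule ccontr)
      assume neg: "\<not> ?thesis"
      have "(\<integral>\<^sup>+t. ennreal (\<phi> g_op t) \<partial>M) < (\<integral>\<^sup>+t. ennreal (\<phi> g t) \<partial>M)"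
      proof (rule nn_integral_less[OF _ _ _ _ neg])
        show "(\<integral>\<^sup>+t. ennreal (\<phi> g_op t) \<partial>M) \<noteq> \<infinity>" using op_fin by (simp add: cost)
        show "AE t in M. ennreal (\<phi> g_op t) \<le> ennreal (\<phi> g t)"
          using le g_ge by (intro AE_I2 ennreal_leI) (auto simp: space)
      qed (use \<phi>_M g_M g_op_M in auto)
      then show False using g_le by (simp add: cost)
    qed
    then show ?thesis
    proof (rule AE_mp[OF _ AE_I2], intro impI)
      fix t assume t: "t \<in> space M" and "ennreal (\<phi> g t) \<le> ennreal (\<phi> g_op t)"
      \<comment> \<open>\<open>ennreal\<close> truncates negative reals to \<open>0\<close>, so the
        return to the reals relies on \<open>\<phi> g_op t\<close> being nonnegative.\<close>
      then have "\<phi> g t \<le> \<phi> g_op t"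
        using \<phi>_nonneg[of t g_op] by (auto simp: space g_op ennreal_le_iff)
      then show "g t = g_op t" using less[of t g] g_ge[of t] t by (force simp: space)
    qed
  qed
  then show ?thesis using optimal unfolding M_def by blast
qed

end
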